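(* Let $\mathcal{H}=\mathcal{H}_1$ be a real Hilbert space having Opial's property, $\mathcal{H}_2$ a real Hilbert space, $g_1:\mathcal{H}_1\to\mathcal{H}_1$ a $\mu$-inverse strongly monotone mapping, $g_2:\mathcal{H}_2\to\mathcal{H}_2$ a $\nu$-inverse strongly monotone mapping ($\mu,\nu>0$), $\mathcal{B}_1:\mathcal{H}_1\to 2^{\mathcal{H}_1}$ and $\mathcal{B}_2:\mathcal{H}_2\to 2^{\mathcal{H}_2}$ maximal monotone mappings, and $\mathcal{A}:\mathcal{H}_1\to\mathcal{H}_2$ a bounded linear operator with adjoint $\mathcal{A}^*$. Let $\lambda>0$, $\gamma\in\left(0,\frac{2}{\|\mathcal{A}^*\mathcal{A}\|}\right)$ and put $$\mathcal{U}=\mathfrak{J}^{\mathcal{B}_1}_\lambda(I-\lambda g_1),\quad \mathcal{V}=\mathfrak{J}^{\mathcal{B}_2}_\lambda(I-\lambda g_2),\quad \mathfrak{J}'=\mathcal{U}\,(I+\gamma\mathcal{A}^*(\mathcal{V}-I)\mathcal{A}).$$ Suppose that $\mathcal{S}:\mathcal{H}\to\mathcal{H}$ and $\mathfrak{J}':\mathcal{H}\to\mathcal{H}$ are nonexpansive and that $\Sigma=\mathcal{F}(\mathcal{S})\cap\Omega\neq\emptyset$. Let $x_0,x_1\in\mathcal{H}$ and let $\{x_n\}$ be generated, for $n\ge 1$, by $$w_n=x_n+\theta_n(x_n-x_{n-1}),\quad y_n=(1-\beta_n)w_n+\beta_n\mathcal{S}w_n,\quad x_{n+1}=(1-\alpha_n)\mathcal{S}y_n+\alpha_n\mathfrak{J}'y_n,$$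 where: (D1) $\sum_{n=1}^{\infty}\theta_n<\infty$ and $\{\theta_n\}\subset[0,\theta]$ for some $0\le\theta<1$; (D2) $\{\alpha_n\},\{\beta_n\}\subset[\delta,1-\delta]$ for some $\delta\in(0,0.5)$; (D3) $\{\mathcal{S}(w_n)-w_n\}$ and $\{\mathcal{S}(w_n)-x^*\}$ are bounded for any $x^*\in\Sigma$; (D4) $\{\mathfrak{J}'(w_n)-w_n\}$ and $\{\mathfrak{J}'(w_n)-x^*\}$ are bounded for any $x^*\in\Sigma$. Then $\{x_n\}$ converges weakly to a common fixed point of $\mathcal{S}$ and $\mathfrak{J}'$.
   Context: A mapping $\mathcal{S}:\mathcal{H}\to\mathcal{H}$ is nonexpansive if $\|\mathcal{S}x-\mathcal{S}y\|\le\|x-y\|$ for all $x,y$; $\mathcal{F}(\mathcal{S})=\{x\in\mathcal{H}:\mathcal{S}x=x\}$. A mapping $g$ is $\beta$-inverse strongly monotone ($\beta>0$) if $\langle g(x)-g(y),x-y\rangle\ge\beta\|g(x)-g(y)\|^2$ for all $x,y$. A set-valued $\mathcal{M}:\mathcal{H}\to2^{\mathcal{H}}$ is monotone if $\langle x-y,u-v\rangle\ge0$ whenever $u\in\mathcal{M}(x)$, $v\in\mathcal{M}(y)$, and maximal monotone if moreover its graph is not properly contained in the graph of another monotone set-valued mapping. The resolvent of a maximal monotone $\mathcal{M}$ with parameter $\lambda>0$ is the single-valued mapping $\mathfrak{J}^{\mathcal{M}}_\lambda=(I+\lambda\mathcal{M})^{-1}$ defined on all of $\mathcal{H}$. $I$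 is the identity. $\Omega$ is the solution set of the split monotone inclusion problem: $$\Omega=\{x^*\in\mathcal{H}_1:\ 0\in g_1(x^* )+\mathcal{B}_1(x^* )\ \text{and}\ 0\in g_2(\mathcal{A}x^* )+\mathcal{B}_2(\mathcal{A}x^* )\}.$$ A Hilbert space $\mathcal{H}$ has Opial's property if whenever a sequence $\{x_n\}$ in $\mathcal{H}$ converges weakly to $x$, then $\liminf_{n\to\infty}\|x_n-x\|\le\liminf_{n\to\infty}\|x_n-y\|$ for all $y\in\mathcal{H}$, $y\ne x$. *)

theory Defs
  imports "HOL-Analysis.Analysis"
begin

definition nonexpansive :: "('a::real_normed_vector \<Rightarrow> 'a) \<Rightarrow> bool" where
  "nonexpansive S \<longleftrightarrow> (\<forall>x y. norm (S x - S y) \<le> norm (x - y))"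

definition fixed_points :: "('a \<Rightarrow> 'a) \<Rightarrow> 'a set" where
  "fixed_points S = {x. S x = x}"

definition inverse_strongly_monotone :: "real \<Rightarrow> ('a::real_inner \<Rightarrow> 'a) \<Rightarrow> bool" where
  "inverse_strongly_monotone \<beta> g \<longleftrightarrow>
     \<beta> > 0 \<and> (\<forall>x y. (g x - g y) \<bullet> (x - y) \<ge> \<beta> * (norm (g x - g y))\<^sup>2)"

definition monotone_operator :: "('a::real_inner \<Rightarrow> 'a set) \<Rightarrow> bool" where
  "monotone_operator M \<longleftrightarrow> (\<forall>x y. \<forall>u\<in>M x. \<forall>v\<in>M y. (x - y) \<bullet> (u - v) \<ge> 0)"

definition operator_graph :: "('a \<Rightarrow> 'a set) \<Rightarrow> ('a \<times> 'a) set" where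
  "operator_graph M = {(x, u). u \<in> M x}"

definition maximal_monotone :: "('a::real_inner \<Rightarrow> 'a set) \<Rightarrow> bool" where
  "maximal_monotone M \<longleftrightarrow> monotone_operator M \<and>
     \<not> (\<exists>N. monotone_operator N \<and> operator_graph M \<subset> operator_graph N)"

text \<open>The value at \<open>x\<close> of the single-valued inverse of \<open>I + r M\<close>: the unique \<open>y\<close> with
  \<open>x \<in> y + r M y\<close>.  For a maximal monotone \<open>M\<close> on a Hilbert space and \<open>r > 0\<close> such a \<open>y\<close>
  exists for every \<open>x\<close> (Minty), so the description is proper; it is unspecified otherwise.\<close>

definition resolvent :: "('a::real_inner \<Rightarrow> 'a set) \<Rightarrow> real \<Rightarrow> 'a \<Rightarrow> 'a" where
  "resolvent M r x = (THE y. x \<in> (\<lambda>u. y + r *\<^sub>R u) ` M y)"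

definition split_inclusion_solutions ::
  "('a::real_inner \<Rightarrow> 'a) \<Rightarrow> ('a \<Rightarrow> 'a set) \<Rightarrow> ('b::real_inner \<Rightarrow> 'b) \<Rightarrow> ('b \<Rightarrow> 'b set) \<Rightarrow> ('a \<Rightarrow> 'b) \<Rightarrow> 'a set"
where
  "split_inclusion_solutions g1 B1 g2 B2 A =
     {x. 0 \<in> (\<lambda>u. g1 x + u) ` B1 x \<and> 0 \<in> (\<lambda>v. g2 (A x) + v) ` B2 (A x)}"

definition weakly_converges :: "(nat \<Rightarrow> 'a::real_normed_vector) \<Rightarrow> 'a \<Rightarrow> bool" where
  "weakly_converges X l \<longleftrightarrow>
     (\<forall>f :: 'a \<Rightarrow> real. bounded_linear f \<longrightarrow> (\<lambda>n. f (X n)) \<longlonglongrightarrow> f l)"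

text \<open>A property of the space, hence of its type.  The inequality is non-strict here, unlike in
  the usual form of Opial's condition.\<close>

definition opial_property :: "'a::real_normed_vector itself \<Rightarrow> bool" where
  "opial_property TYPE('a) \<longleftrightarrow>
     (\<forall>(X :: nat \<Rightarrow> 'a) x. weakly_converges X x \<longrightarrow>
        (\<forall>y. y \<noteq> x \<longrightarrow>
           liminf (\<lambda>n. ereal (norm (X n - x))) \<le> liminf (\<lambda>n. ereal (norm (X n - y)))))"

end

theory Submission
  imports Defs
begin

text \<open>
  Every common fixed point \<open>p\<close> of \<open>S\<close> and \<open>J'\<close> satisfies
  \<open>\<parallel>x (n+1) - p\<parallel> \<le> \<parallel>x n - p\<parallel> + \<theta> n * \<parallel>x n - x (n-1)\<parallel>\<close> with summable errors, so
  \<open>\<parallel>x n - p\<parallel>\<close> converges, and the strong convexity of \<open>\<parallel>\<cdot>\<parallel>\<^sup>2\<close> then forces \<open>x n - S (x n)\<close> and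
  \<open>x n - J' (x n)\<close> to tend to 0.  Weak compactness is replaced by asymptotic centres: along any
  filter the limit superior of \<open>\<parallel>x n - z\<parallel>\<^sup>2\<close> has a minimiser in \<open>z\<close>, which is a common fixed
  point by its uniqueness.  Since \<open>\<parallel>x n - q\<parallel>\<close> converges for all common fixed points \<open>q\<close>, the
  centre of the whole sequence is a centre along every finer filter, and a small step from it in
  a direction \<open>v\<close> with \<open>(x n - q) \<bullet> v\<close> frequently large would decrease the radius.
  The same minimisation principle, applied to \<open>\<parallel>z\<parallel>\<^sup>2 - 2 f z\<close>, yields the Riesz representation.
\<close>

section \<open>Minimisation of midpoint-convex functions, Riesz representation and adjoints\<close>

text \<open>The quadratic term in \<open>mid\<close> makes a minimising sequence Cauchy, because the
  value at a midpoint cannot fall below the infimum; continuity then carries the infimum to the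
  limit.\<close>

lemma midpoint_convex_attains_minimum:
  fixes \<phi> :: "'a::{real_inner, complete_space} \<Rightarrow> real"
  assumes cont: "continuous_on UNIV \<phi>"
    and bdd: "\<And>z. m \<le> \<phi> z"
    and mid: "\<And>a b. \<phi> ((1/2) *\<^sub>R (a + b)) \<le> (\<phi> a + \<phi> b) / 2 - (norm (a - b))\<^sup>2 / 4"
  shows "\<exists>c. \<forall>z. \<phi> c \<le> \<phi> z"
proof -
  define I where "I = Inf (range \<phi>)"
  have bb: "bdd_below (range \<phi>)" using bdd by (intro bdd_belowI[of _ m]) auto
  have I: "I \<le> \<phi> z" for z unfolding I_def by (rule cInf_lower[OF _ bb]) auto
  have "\<exists>z. \<phi> z < I + inverse (real (Suc n))" for n
    using cInf_lessD[of "range \<phi>" "I + inverse (real (Suc n))"] by (auto simp: I_def)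
  then obtain Z where Z: "\<And>n. \<phi> (Z n) < I + inverse (real (Suc n))" by metis
  have est: "(norm (Z j - Z k))\<^sup>2 \<le> 2 * (inverse (real (Suc j)) + inverse (real (Suc k)))" for j k
    using mid[of "Z j" "Z k"] I[of "(1/2) *\<^sub>R (Z j + Z k)"] Z[of j] Z[of k] by argo
  have "Cauchy Z"
  proof (rule metric_CauchyI)
    fix e :: real assume "e > 0"
    \<comment> \<open>With both inverses below \<open>e\<^sup>2 / 4\<close>, the bound in
      \<open>est\<close> is below \<open>e\<^sup>2\<close>.\<close>
    then obtain M where M: "inverse (real (Suc M)) < e\<^sup>2 / 4"
      using reals_Archimedean[of "e\<^sup>2 / 4"] by auto
    have "dist (Z j) (Z k) < e" if "j \<ge> M" "k \<ge> M" for j k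
    proof -
      have "inverse (real (Suc j)) \<le> inverse (real (Suc M))"
        "inverse (real (Suc k)) \<le> inverse (real (Suc M))"
        using that by (auto intro!: le_imp_inverse_le)
      then have "(norm (Z j - Z k))\<^sup>2 < e\<^sup>2" using est[of j k] M by argo
      then show ?thesis using \<open>e > 0\<close> power2_less_imp_less[of "norm (Z j - Z k)" e]
        by (simp add: dist_norm)
    qed
    then show "\<exists>M. \<forall>j\<ge>M. \<forall>k\<ge>M. dist (Z j) (Z k) < e" by blast
  qed
  then obtain c where c: "Z \<longlonglongrightarrow> c" using Cauchy_convergent convergent_def by blast
  have "(\<lambda>n. \<phi> (Z n)) \<longlonglongrightarrow> \<phi> c"
    using cont c by (auto simp: continuous_on_eq_continuous_at intro: isCont_tendsto_compose)
  moreover have "(\<lambda>n. I + inverse (real (Suc n))) \<longlonglongrightarrow> I + 0"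
    by (intro tendsto_intros LIMSEQ_inverse_real_of_nat)
  ultimately have "\<phi> c \<le> I + 0"
    using Z by (intro LIMSEQ_le) (auto intro: less_imp_le)
  then show ?thesis using I by (auto intro: order_trans)
qed

lemma quadratic_nonneg_imp_linear_zero:
  fixes a b :: real
  assumes "\<And>t. 0 \<le> a * t\<^sup>2 + b * t"
  shows "b = 0"
proof (rule ccontr)
  assume b: "b \<noteq> 0"
  \<comment> \<open>Any \<open>k\<close> with \<open>k > 0\<close> and \<open>k > a\<close> would
    do: at \<open>t = - b / k\<close> the quadratic equals
    \<open>(b\<^sup>2 / k) * (a / k - 1)\<close>, which is negative.\<close>
  define k where "k = \<bar>a\<bar> + 1"
  have k: "k > 0" "a < k" by (auto simp: k_def)
  have "a * (- b / k)\<^sup>2 + b * (- b / k) = (b\<^sup>2 / k) * (a / k - 1)"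
    using k by (simp add: field_simps power2_eq_square)
  moreover have "(b\<^sup>2 / k) * (a / k - 1) < 0"
    using b k by (intro mult_pos_neg) (auto simp: field_simps)
  ultimately show False using assms[of "- b / k"] by linarith
qed

text \<open>If \<open>q\<close> represents \<open>f\<close>, then \<open>\<phi> z\<close> is
  \<open>(norm (z - q))\<^sup>2 - (norm q)\<^sup>2\<close>. So the representing vector is found as
  the minimiser of \<open>\<phi>\<close>, and the identity is the first-order condition
  there.\<close>

lemma Riesz_representation:
  fixes f :: "'a::{real_inner, complete_space} \<Rightarrow> real"
  assumes f: "bounded_linear f"
  shows "\<exists>q. \<forall>v. f v = v \<bullet> q"
proof -
  interpret f: bounded_linear f by fact
  define \<phi> where "\<phi> z = (norm z)\<^sup>2 - 2 * f z" for z
  obtain K where K: "\<And>z. norm (f z) \<le> norm z * K" using f.bounded by blast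
  have "\<exists>c. \<forall>z. \<phi> c \<le> \<phi> z"
  proof (rule midpoint_convex_attains_minimum)
    show "continuous_on UNIV \<phi>"
      unfolding \<phi>_def by (intro continuous_intros f.continuous_on)
    \<comment> \<open>Completing the square in
      \<open>(norm z)\<^sup>2 - 2 * K * norm z\<close>.\<close>
    show "- K\<^sup>2 \<le> \<phi> z" for z
    proof -
      have "f z \<le> norm z * K" using K[of z] by simp
      then show ?thesis using zero_le_power2[of "norm z - K"]
        unfolding \<phi>_def by (simp add: power2_diff)
    qed
    show "\<phi> ((1/2) *\<^sub>R (a + b)) \<le> (\<phi> a + \<phi> b) / 2 - (norm (a - b))\<^sup>2 / 4" for a b
      unfolding \<phi>_def by (simp add: f.add f.scaleR power2_norm_eq_inner inner_simps inner_commute field_simps)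
  qed
  then obtain c where c: "\<And>z. \<phi> c \<le> \<phi> z" by blast
  have "f v = v \<bullet> c" for v
  proof -
    have "0 \<le> (norm v)\<^sup>2 * t\<^sup>2 + (2 * (v \<bullet> c - f v)) * t" for t
      using c[of "c + t *\<^sub>R v"] unfolding \<phi>_def
      by (simp add: f.add f.scaleR power2_norm_eq_inner inner_simps inner_commute
          algebra_simps power2_eq_square[of t])
    then show ?thesis using quadratic_nonneg_imp_linear_zero by fastforce
  qed
  then show ?thesis by blast
qed

text \<open>\<open>adjoint\<close> is defined by choice, so its characteristic identity rests on the
  existence of an adjoint map, which Riesz representation provides for each
  \<open>v\<close>.\<close>

lemma adjoint_Hilbert:
  fixes A :: "'a::{real_inner, complete_space} \<Rightarrow> 'b::real_inner"
  assumes "bounded_linear A"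
  shows "A u \<bullet> v = u \<bullet> adjoint A v"
proof -
  have "\<exists>q. \<forall>u. A u \<bullet> v = u \<bullet> q" for v
    using assms by (intro Riesz_representation bounded_linear_inner_left_comp)
  then have "\<exists>A'. \<forall>u v. A u \<bullet> v = u \<bullet> A' v" by metis
  then have "\<forall>u v. A u \<bullet> v = u \<bullet> adjoint A v"
    unfolding adjoint_def by (rule someI_ex)
  then show ?thesis by blast
qed

lemma adjoint_zero:
  fixes A :: "'a::{real_inner, complete_space} \<Rightarrow> 'b::real_inner"
  assumes "bounded_linear A"
  shows "adjoint A 0 = 0"
  using adjoint_Hilbert[OF assms, of "adjoint A 0" 0] by simp

section \<open>Resolvents and fixed points of forward-backward maps\<close>

text \<open>Two candidates \<open>y\<close>, \<open>z\<close> with operator values \<open>u\<close>,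
  \<open>v\<close> satisfy \<open>z - y = - r *\<^sub>R (v - u)\<close>, so monotonicity forces
  \<open>u = v\<close> and the description in \<open>resolvent\<close> is unique.\<close>

lemma resolvent_eqI:
  assumes M: "monotone_operator M" and r: "r > 0"
    and u: "u \<in> M y" "x = y + r *\<^sub>R u"
  shows "resolvent M r x = y"
  unfolding resolvent_def
proof (rule the_equality)
  show "x \<in> (\<lambda>u. y + r *\<^sub>R u) ` M y" using u by blast
next
  fix z assume "x \<in> (\<lambda>u. z + r *\<^sub>R u) ` M z"
  then obtain v where v: "v \<in> M z" "x = z + r *\<^sub>R v" by blast
  have "0 \<le> (z - y) \<bullet> (v - u)"
    using M u v unfolding monotone_operator_def by blast
  moreover have zy: "z - y = - r *\<^sub>R (v - u)"
    using u v by (simp add: algebra_simps)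
  ultimately have "r * ((v - u) \<bullet> (v - u)) \<le> 0" by simp
  then have "(v - u) \<bullet> (v - u) \<le> 0" using r by (simp add: mult_le_0_iff)
  then have "v - u = 0" by (metis inner_eq_zero_iff inner_ge_zero order_antisym)
  then show "z = y" using zy by simp
qed

text \<open>The inclusion says \<open>- g z \<in> B z\<close>, so the forward step from
  \<open>z\<close> is exactly \<open>z + r *\<^sub>R u\<close> with
  \<open>u = - g z\<close>.\<close>

lemma forward_backward_fixed_point:
  assumes "monotone_operator B" "r > 0" "0 \<in> (\<lambda>u. g z + u) ` B z"
  shows "resolvent B r (z - r *\<^sub>R g z) = z"
proof -
  have "- g z \<in> B z" using assms(3) by (metis add_eq_0_iff imageE)
  then show ?thesis using assms by (intro resolvent_eqI) auto
qed

section \<open>Asymptotic radii and centres along a filter\<close>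

text \<open>For bounded \<open>X\<close> and a nontrivial filter this is the limit superior of the
  squared distances, written as an infimum of eventual bounds so that it is a real number. A general
  filter lets finer filters stand in for subsequences.\<close>

definition asymptotic_radius_sq ::
  "'i filter \<Rightarrow> ('i \<Rightarrow> 'a::real_normed_vector) \<Rightarrow> 'a \<Rightarrow> real" where
  "asymptotic_radius_sq F X z = Inf {e. \<forall>\<^sub>F n in F. (norm (X n - z))\<^sup>2 \<le> e}"

context
  fixes F :: "'i filter" and X :: "'i \<Rightarrow> 'a::real_normed_vector"
  assumes F: "F \<noteq> bot"
begin

lemma asymptotic_radius_sq_le:
  assumes "\<forall>\<^sub>F n in F. (norm (X n - z))\<^sup>2 \<le> e"
  shows "asymptotic_radius_sq F X z \<le> e"
  unfolding asymptotic_radius_sq_def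
proof (rule cInf_lower)
  \<comment> \<open>Nontriviality of \<open>F\<close> enters here: along \<open>bot\<close> every
    real number would be an eventual bound.\<close>
  show "bdd_below {e. \<forall>\<^sub>F n in F. (norm (X n - z))\<^sup>2 \<le> e}"
  proof (rule bdd_belowI)
    fix e assume "e \<in> {e. \<forall>\<^sub>F n in F. (norm (X n - z))\<^sup>2 \<le> e}"
    then have "\<exists>n. (norm (X n - z))\<^sup>2 \<le> e" using F eventually_happens by blast
    then show "0 \<le> e" using order_trans zero_le_power2 by blast
  qed
qed (use assms in simp)

context
  assumes X: "bounded (range X)"
begin

lemma eventually_le_asymptotic_radius_sq:
  assumes "asymptotic_radius_sq F X z < e"
  shows "\<forall>\<^sub>F n in F. (norm (X n - z))\<^sup>2 \<le> e"
proof -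
  obtain K where K: "\<And>n. norm (X n) \<le> K" using X by (auto simp: bounded_iff)
  have "(norm (X n - z))\<^sup>2 \<le> (K + norm z)\<^sup>2" for n
    using K[of n] norm_triangle_ineq4[of "X n" z] by (intro power_mono) auto
  then have "{e. \<forall>\<^sub>F n in F. (norm (X n - z))\<^sup>2 \<le> e} \<noteq> {}"
    by (auto intro!: exI[of _ "(K + norm z)\<^sup>2"])
  then obtain e' where e': "\<forall>\<^sub>F n in F. (norm (X n - z))\<^sup>2 \<le> e'" "e' < e"
    using cInf_lessD[OF _ assms[unfolded asymptotic_radius_sq_def]] by auto
  from e'(1) show ?thesis by eventually_elim (use e'(2) in simp)
qed

text \<open>Transfers a termwise comparison of distances to two points into a comparison of their
  radii.\<close>

lemma asymptotic_radius_sq_le_add: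
  assumes le: "\<forall>\<^sub>F n in F. (norm (X n - z))\<^sup>2 \<le> (norm (X n - z'))\<^sup>2 + d n"
    and d: "(d \<longlongrightarrow> D) F"
  shows "asymptotic_radius_sq F X z \<le> asymptotic_radius_sq F X z' + D"
proof (rule field_le_epsilon)
  fix e :: real assume e: "e > 0"
  have "\<forall>\<^sub>F n in F. (norm (X n - z'))\<^sup>2 \<le> asymptotic_radius_sq F X z' + e / 2"
    using e by (intro eventually_le_asymptotic_radius_sq) auto
  moreover have "\<forall>\<^sub>F n in F. d n < D + e / 2" using e d by (intro order_tendstoD) auto
  ultimately have "\<forall>\<^sub>F n in F. (norm (X n - z))\<^sup>2 \<le> asymptotic_radius_sq F X z' + D + e"
    using le by eventually_elim auto
  then show "asymptotic_radius_sq F X z \<le> asymptotic_radius_sq F X z' + D + e"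
    by (rule asymptotic_radius_sq_le)
qed

lemma asymptotic_radius_sq_eq:
  assumes "((\<lambda>n. norm (X n - z)) \<longlongrightarrow> l) F"
  shows "asymptotic_radius_sq F X z = l\<^sup>2"
proof -
  have lim: "((\<lambda>n. (norm (X n - z))\<^sup>2) \<longlongrightarrow> l\<^sup>2) F" using assms by (intro tendsto_intros)
  show ?thesis
  proof (rule antisym)
    show "asymptotic_radius_sq F X z \<le> l\<^sup>2"
    proof (rule field_le_epsilon)
      fix e :: real assume "e > 0"
      then have "\<forall>\<^sub>F n in F. (norm (X n - z))\<^sup>2 < l\<^sup>2 + e" using lim by (intro order_tendstoD) auto
      then show "asymptotic_radius_sq F X z \<le> l\<^sup>2 + e"
        by (intro asymptotic_radius_sq_le) (auto elim: eventually_mono)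
    qed
    show "l\<^sup>2 \<le> asymptotic_radius_sq F X z"
      by (rule field_le_epsilon)
        (auto intro!: tendsto_upperbound[OF lim _ F] eventually_le_asymptotic_radius_sq)
  qed
qed

end
end

text \<open>The parallelogram identity for each \<open>X n\<close> passes to the radius, so the
  minimisation principle applies; the same quadratic gap makes the minimiser unique.\<close>

lemma asymptotic_centre_exists:
  fixes X :: "'i \<Rightarrow> 'a::{real_inner, complete_space}"
  assumes F: "F \<noteq> bot" and X: "bounded (range X)"
  obtains c where "\<And>z. asymptotic_radius_sq F X c \<le> asymptotic_radius_sq F X z"
    and "\<And>z. asymptotic_radius_sq F X z \<le> asymptotic_radius_sq F X c \<Longrightarrow> z = c"
proof -
  let ?\<phi> = "asymptotic_radius_sq F X"
  obtain K where K: "\<And>n. norm (X n) \<le> K" using X by (auto simp: bounded_iff)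
  \<comment> \<open>A local Lipschitz estimate, which later gives continuity: the difference of the
    two squares factors as an inner product.\<close>
  have diff: "?\<phi> a \<le> ?\<phi> b + norm (a - b) * (2 * K + norm a + norm b)" for a b
  proof (rule asymptotic_radius_sq_le_add[OF F X])
    show "\<forall>\<^sub>F n in F. (norm (X n - a))\<^sup>2 \<le> (norm (X n - b))\<^sup>2
        + norm (a - b) * (2 * K + norm a + norm b)"
    proof (intro always_eventually allI)
      fix n
      have "(norm (X n - a))\<^sup>2 - (norm (X n - b))\<^sup>2 = (b - a) \<bullet> (X n - a + (X n - b))"
        by (simp add: power2_norm_eq_inner inner_simps inner_commute)
      also have "\<dots> \<le> norm (b - a) * norm (X n - a + (X n - b))" by (rule norm_cauchy_schwarz)
      also have "\<dots> \<le> norm (b - a) * (2 * K + norm a + norm b)"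
        using K[of n] norm_triangle_ineq[of "X n - a" "X n - b"]
          norm_triangle_ineq4[of "X n" a] norm_triangle_ineq4[of "X n" b]
        by (intro mult_left_mono) auto
      finally show "(norm (X n - a))\<^sup>2 \<le> (norm (X n - b))\<^sup>2
        + norm (a - b) * (2 * K + norm a + norm b)" by (simp add: norm_minus_commute)
    qed
  qed simp
  have mid: "?\<phi> ((1/2) *\<^sub>R (a + b)) \<le> (?\<phi> a + ?\<phi> b) / 2 - (norm (a - b))\<^sup>2 / 4" for a b
  proof (rule field_le_epsilon)
    fix e :: real assume e: "e > 0"
    have "\<forall>\<^sub>F n in F. (norm (X n - a))\<^sup>2 \<le> ?\<phi> a + e" "\<forall>\<^sub>F n in F. (norm (X n - b))\<^sup>2 \<le> ?\<phi> b + e"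
      using e by (auto intro: eventually_le_asymptotic_radius_sq[OF F X])
    then have "\<forall>\<^sub>F n in F. (norm (X n - (1/2) *\<^sub>R (a + b)))\<^sup>2
        \<le> (?\<phi> a + ?\<phi> b) / 2 - (norm (a - b))\<^sup>2 / 4 + e"
    proof eventually_elim
      case (elim n)
      have "(norm (X n - (1/2) *\<^sub>R (a + b)))\<^sup>2
          = ((norm (X n - a))\<^sup>2 + (norm (X n - b))\<^sup>2) / 2 - (norm (a - b))\<^sup>2 / 4"
        by (simp add: power2_norm_eq_inner inner_simps inner_commute field_simps)
      then show ?case using elim by argo
    qed
    then show "?\<phi> ((1/2) *\<^sub>R (a + b)) \<le> (?\<phi> a + ?\<phi> b) / 2 - (norm (a - b))\<^sup>2 / 4 + e"
      by (rule asymptotic_radius_sq_le[OF F])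
  qed
  have "\<exists>c. \<forall>z. ?\<phi> c \<le> ?\<phi> z"
  proof (rule midpoint_convex_attains_minimum[OF _ _ mid])
    show "continuous_on UNIV ?\<phi>"
      unfolding continuous_on_def
    proof
      fix b :: 'a
      have "((\<lambda>a. norm (a - b) * (2 * K + norm a + norm b)) \<longlongrightarrow>
          norm (b - b) * (2 * K + norm b + norm b)) (at b)"
        by (intro tendsto_intros)
      then have lim: "((\<lambda>a. norm (a - b) * (2 * K + norm a + norm b)) \<longlongrightarrow> 0) (at b)" by simp
      have "\<bar>?\<phi> a - ?\<phi> b\<bar> \<le> norm (a - b) * (2 * K + norm a + norm b)" for a
        using diff[of a b] diff[of b a] by (simp add: norm_minus_commute algebra_simps)
      then have "((\<lambda>a. ?\<phi> a - ?\<phi> b) \<longlongrightarrow> 0) (at b)"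
        by (intro Lim_null_comparison[OF _ lim]) auto
      then show "(?\<phi> \<longlongrightarrow> ?\<phi> b) (at b within UNIV)" by (simp add: LIM_zero_iff)
    qed
    show "0 \<le> ?\<phi> z" for z
    proof (rule field_le_epsilon)
      fix e :: real assume "e > 0"
      then have "\<exists>n. (norm (X n - z))\<^sup>2 \<le> ?\<phi> z + e"
        using eventually_happens[OF eventually_le_asymptotic_radius_sq[OF F X]] F by auto
      then show "0 \<le> ?\<phi> z + e" using order_trans zero_le_power2 by blast
    qed
  qed
  then obtain c where c: "\<And>z. ?\<phi> c \<le> ?\<phi> z" by blast
  have "z = c" if "?\<phi> z \<le> ?\<phi> c" for z
  proof -
    have "(norm (z - c))\<^sup>2 \<le> 0" using mid[of z c] c[of "(1/2) *\<^sub>R (z + c)"] that by argo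
    then show ?thesis by simp
  qed
  with c show ?thesis by (rule that)
qed

text \<open>Since \<open>X n\<close> is almost fixed by \<open>T\<close>, it is asymptotically no
  farther from \<open>T c\<close> than from \<open>c\<close>; so \<open>T c\<close> is a centre as
  well. This takes the role of demiclosedness of the identity minus \<open>T\<close> at 0.\<close>

lemma asymptotic_centre_fixed_point:
  fixes X :: "'i \<Rightarrow> 'a::real_normed_vector"
  assumes F: "F \<noteq> bot" and X: "bounded (range X)" and T: "nonexpansive T"
    and lim: "((\<lambda>n. X n - T (X n)) \<longlongrightarrow> 0) F"
    and uniq: "\<And>z. asymptotic_radius_sq F X z \<le> asymptotic_radius_sq F X c \<Longrightarrow> z = c"
  shows "T c = c"
proof (rule uniq)
  obtain K where K: "\<And>n. norm (X n) \<le> K" using X by (auto simp: bounded_iff)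
  define d where "d n = norm (X n - T (X n))" for n
  have d: "(d \<longlongrightarrow> 0) F" unfolding d_def using lim by (rule tendsto_norm_zero)
  have "((\<lambda>n. (d n)\<^sup>2 + 2 * (K + norm c) * d n) \<longlongrightarrow> 0\<^sup>2 + 2 * (K + norm c) * 0) F"
    by (intro tendsto_intros d)
  moreover have "(norm (X n - T c))\<^sup>2 \<le> (norm (X n - c))\<^sup>2 + ((d n)\<^sup>2 + 2 * (K + norm c) * d n)" for n
  proof -
    have "norm (X n - T c) \<le> d n + norm (T (X n) - T c)"
      unfolding d_def using norm_triangle_ineq[of "X n - T (X n)" "T (X n) - T c"] by simp
    also have "norm (T (X n) - T c) \<le> norm (X n - c)" using T by (simp add: nonexpansive_def)
    finally have "(norm (X n - T c))\<^sup>2 \<le> (d n + norm (X n - c))\<^sup>2" by (intro power_mono) auto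
    also have "\<dots> = (norm (X n - c))\<^sup>2 + ((d n)\<^sup>2 + 2 * norm (X n - c) * d n)"
      by (simp add: power2_sum)
    also have "2 * norm (X n - c) * d n \<le> 2 * (K + norm c) * d n"
      using K[of n] norm_triangle_ineq4[of "X n" c] by (intro mult_right_mono) (auto simp: d_def)
    finally show ?thesis by simp
  qed
  ultimately have "asymptotic_radius_sq F X (T c)
      \<le> asymptotic_radius_sq F X c + (0\<^sup>2 + 2 * (K + norm c) * 0)"
    by (intro asymptotic_radius_sq_le_add[OF F X]) auto
  then show "asymptotic_radius_sq F X (T c) \<le> asymptotic_radius_sq F X c" by simp
qed

section \<open>Weak convergence from convergent distances to common fixed points\<close>

text \<open>A form of Opial's lemma, with finer filters in the role of subsequences and asymptotic
  centres in that of weak cluster points.\<close>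

lemma weak_convergence_to_common_fixed_point:
  fixes X :: "nat \<Rightarrow> 'a::{real_inner, complete_space}"
  assumes X: "bounded (range X)"
    and nonexp: "\<And>T. T \<in> \<T> \<Longrightarrow> nonexpansive T"
    and lim: "\<And>T. T \<in> \<T> \<Longrightarrow> (\<lambda>n. X n - T (X n)) \<longlonglongrightarrow> 0"
    and conv: "\<And>q. (\<And>T. T \<in> \<T> \<Longrightarrow> T q = q) \<Longrightarrow> convergent (\<lambda>n. norm (X n - q))"
  shows "\<exists>q. (\<forall>T\<in>\<T>. T q = q) \<and> weakly_converges X q"
proof -
  have centre: "\<exists>c. (\<forall>T\<in>\<T>. T c = c)
      \<and> (\<forall>z. asymptotic_radius_sq F X c \<le> asymptotic_radius_sq F X z)"
    if F: "F \<noteq> bot" "F \<le> sequentially" for F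
  proof -
    obtain c where c: "\<And>z. asymptotic_radius_sq F X c \<le> asymptotic_radius_sq F X z"
      "\<And>z. asymptotic_radius_sq F X z \<le> asymptotic_radius_sq F X c \<Longrightarrow> z = c"
      using asymptotic_centre_exists[OF F(1) X] by blast
    have "T c = c" if "T \<in> \<T>" for T
      by (rule asymptotic_centre_fixed_point[OF F(1) X nonexp[OF that] tendsto_mono[OF F(2) lim[OF that]] c(2)])
    with c show ?thesis by blast
  qed
  obtain c where cfix: "\<forall>T\<in>\<T>. T c = c"
    and cmin: "\<And>z. asymptotic_radius_sq sequentially X c \<le> asymptotic_radius_sq sequentially X z"
    using centre[of sequentially] by auto
  have freq: "\<not> (\<exists>\<^sub>F n in sequentially. e \<le> (X n - c) \<bullet> v)" if e: "e > 0" for e v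
  proof
    assume fr: "\<exists>\<^sub>F n in sequentially. e \<le> (X n - c) \<bullet> v"
    then have v: "v \<noteq> 0" using e by (auto dest: frequently_ex)
    \<comment> \<open>The filter of the offending indices, nontrivial because they occur
      frequently.\<close>
    define F where "F = inf sequentially (principal {n. e \<le> (X n - c) \<bullet> v})"
    have F: "F \<noteq> bot" "F \<le> sequentially"
      using fr by (auto simp: F_def trivial_limit_def eventually_inf_principal frequently_def)
    obtain c' where c'fix: "\<forall>T\<in>\<T>. T c' = c'"
      and c'min: "\<And>z. asymptotic_radius_sq F X c' \<le> asymptotic_radius_sq F X z"
      using centre[OF F] by auto
    \<comment> \<open>At a common fixed point the distances converge, with the same limit along
      \<open>F\<close>. Hence \<open>c\<close> still has the least radius along \<open>F\<close>:
      its radius is at most that of the centre \<open>c'\<close>.\<close>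
    have same: "asymptotic_radius_sq F X q = asymptotic_radius_sq sequentially X q"
      if q: "\<forall>T\<in>\<T>. T q = q" for q
    proof -
      obtain l where l: "(\<lambda>n. norm (X n - q)) \<longlonglongrightarrow> l" using conv q convergent_def by blast
      show ?thesis
        using asymptotic_radius_sq_eq[OF _ X l] asymptotic_radius_sq_eq[OF F(1) X tendsto_mono[OF F(2) l]]
        by simp
    qed
    \<comment> \<open>This step length minimises
      \<open>- 2 * t * e + t\<^sup>2 * (norm v)\<^sup>2\<close>, with value
      \<open>- (t * e)\<close>.\<close>
    define t where "t = e / (norm v)\<^sup>2"
    have t: "t > 0" "t * (norm v)\<^sup>2 = e" using e v by (auto simp: t_def)
    have "asymptotic_radius_sq F X (c + t *\<^sub>R v) \<le> asymptotic_radius_sq F X c + (- (t * e))"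
    proof (rule asymptotic_radius_sq_le_add[OF F(1) X])
      have "\<forall>\<^sub>F n in F. e \<le> (X n - c) \<bullet> v" by (simp add: F_def eventually_inf_principal)
      then show "\<forall>\<^sub>F n in F. (norm (X n - (c + t *\<^sub>R v)))\<^sup>2 \<le> (norm (X n - c))\<^sup>2 + (- (t * e))"
      proof eventually_elim
        case (elim n)
        have "(norm (X n - (c + t *\<^sub>R v)))\<^sup>2
            = (norm (X n - c))\<^sup>2 - 2 * (t * ((X n - c) \<bullet> v)) + t * (t * (norm v)\<^sup>2)"
          by (simp add: power2_norm_eq_inner inner_simps inner_commute algebra_simps)
        moreover have "t * e \<le> t * ((X n - c) \<bullet> v)" using elim t by simp
        ultimately show ?case unfolding t(2) by argo
      qed
    qed simp
    moreover have "t * e > 0" using t e by simp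
    ultimately show False
      using c'min[of "c + t *\<^sub>R v"] same[OF cfix] same[OF c'fix] cmin[of c'] by linarith
  qed
  have "weakly_converges X c"
    unfolding weakly_converges_def
  proof (intro allI impI)
    fix f :: "'a \<Rightarrow> real" assume "bounded_linear f"
    then obtain v where v: "\<And>u. f u = u \<bullet> v" using Riesz_representation by blast
    show "(\<lambda>n. f (X n)) \<longlonglongrightarrow> f c"
    proof (rule tendstoI)
      fix e :: real assume e: "e > 0"
      \<comment> \<open>Using both \<open>v\<close> and \<open>- v\<close> turns the one-sided bound
        into a bound on the absolute value.\<close>
      have "\<forall>\<^sub>F n in sequentially. (X n - c) \<bullet> v < e" "\<forall>\<^sub>F n in sequentially. (X n - c) \<bullet> (- v) < e"
        using freq[OF e, of v] freq[OF e, of "- v"] by (auto simp: frequently_def not_le)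
      then show "\<forall>\<^sub>F n in sequentially. dist (f (X n)) (f c) < e"
        by eventually_elim (auto simp: v dist_real_def inner_diff_left)
    qed
  qed
  then show ?thesis using cfix by blast
qed

section \<open>Convergence of the inertial iteration\<close>

text \<open>Subtracting the partial sums of the errors leaves a decreasing sequence bounded below by
  \<open>- suminf \<epsilon>\<close>.\<close>

lemma quasi_Fejer_convergent:
  fixes a \<epsilon> :: "nat \<Rightarrow> real"
  assumes a: "\<And>n. 0 \<le> a n" and step: "\<And>n. a (Suc n) \<le> a n + \<epsilon> n"
    and \<epsilon>: "\<And>n. 0 \<le> \<epsilon> n" "summable \<epsilon>"
  shows "convergent a"
proof -
  define b where "b n = a n - sum \<epsilon> {..<n}" for n
  have "decseq b" using step by (intro decseq_SucI) (simp add: b_def add.commute diff_le_eq)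
  moreover have "- suminf \<epsilon> \<le> b n" for n
    using a[of n] sum_le_suminf[OF \<epsilon>(2), of "{..<n}"] \<epsilon>(1) by (simp add: b_def)
  ultimately have "convergent b" by (metis decseq_convergent convergent_def)
  then have "convergent (\<lambda>n. b n + sum \<epsilon> {..<n})"
    using \<epsilon>(2) by (intro convergent_add) (simp_all add: summable_iff_convergent)
  then show ?thesis by (simp add: b_def)
qed

lemma norm_convex_combination_sq:
  fixes a b p :: "'a::real_inner"
  shows "(norm ((1 - t) *\<^sub>R a + t *\<^sub>R b - p))\<^sup>2
    = (1 - t) * (norm (a - p))\<^sup>2 + t * (norm (b - p))\<^sup>2 - t * (1 - t) * (norm (a - b))\<^sup>2"
  by (simp add: power2_norm_eq_inner inner_simps inner_commute algebra_simps)

text \<open>Both weights are at least \<open>\<delta>\<close>, so the deficit coefficient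
  \<open>t * (1 - t)\<close> is at least \<open>\<delta>\<^sup>2\<close>. Both averaging steps of
  the iteration use this.\<close>

lemma norm_convex_combination_sq_le:
  fixes a b p :: "'a::real_inner"
  assumes "norm (a - p) \<le> R" "norm (b - p) \<le> R" "0 \<le> \<delta>" "t \<in> {\<delta>..1 - \<delta>}"
  shows "(norm ((1 - t) *\<^sub>R a + t *\<^sub>R b - p))\<^sup>2 \<le> R\<^sup>2 - \<delta>\<^sup>2 * (norm (a - b))\<^sup>2"
proof -
  have "(1 - t) * (norm (a - p))\<^sup>2 + t * (norm (b - p))\<^sup>2 \<le> (1 - t) * R\<^sup>2 + t * R\<^sup>2"
    using assms by (intro add_mono mult_left_mono power_mono) auto
  moreover have "\<delta>\<^sup>2 \<le> t * (1 - t)"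
    unfolding power2_eq_square using assms by (intro mult_mono) auto
  then have "\<delta>\<^sup>2 * (norm (a - b))\<^sup>2 \<le> t * (1 - t) * (norm (a - b))\<^sup>2"
    by (rule mult_right_mono) simp
  ultimately show ?thesis unfolding norm_convex_combination_sq by (simp add: algebra_simps)
qed

text \<open>All sequences except \<open>x\<close> are shifted by one, so that the recursion holds
  from index 0. Boundedness of \<open>w\<close> bounds \<open>x\<close>, which makes the inertial
  displacements summable.\<close>

lemma inertial_iteration_weak_convergence:
  fixes S T :: "'a::{real_inner, complete_space} \<Rightarrow> 'a"
    and x w y :: "nat \<Rightarrow> 'a" and \<theta> \<alpha> \<beta> :: "nat \<Rightarrow> real"
  assumes S: "nonexpansive S" and T: "nonexpansive T"
    and p: "S p = p" "T p = p"
    and w: "\<And>n. w n = x (Suc n) + \<theta> n *\<^sub>R (x (Suc n) - x n)"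
    and y: "\<And>n. y n = (1 - \<beta> n) *\<^sub>R w n + \<beta> n *\<^sub>R S (w n)"
    and x: "\<And>n. x (Suc (Suc n)) = (1 - \<alpha> n) *\<^sub>R S (y n) + \<alpha> n *\<^sub>R T (y n)"
    and \<theta>: "summable \<theta>" "\<And>n. 0 \<le> \<theta> n"
    and \<delta>: "0 < \<delta>" "\<And>n. \<alpha> n \<in> {\<delta>..1 - \<delta>}" "\<And>n. \<beta> n \<in> {\<delta>..1 - \<delta>}"
    and bdd: "bounded (range w)"
  shows "\<exists>q. S q = q \<and> T q = q \<and> weakly_converges x q"
proof -
  have Sle: "norm (S u - S v) \<le> norm (u - v)" and Tle: "norm (T u - T v) \<le> norm (u - v)" for u v
    using S T by (auto simp: nonexpansive_def)
  have y_le: "(norm (y n - q))\<^sup>2 \<le> (norm (w n - q))\<^sup>2 - \<delta>\<^sup>2 * (norm (w n - S (w n)))\<^sup>2"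
    if "S q = q" for n q
    unfolding y using Sle[of "w n" q] that \<delta> by (intro norm_convex_combination_sq_le) auto
  have x_le: "(norm (x (Suc (Suc n)) - q))\<^sup>2
      \<le> (norm (y n - q))\<^sup>2 - \<delta>\<^sup>2 * (norm (S (y n) - T (y n)))\<^sup>2"
    if "S q = q" "T q = q" for n q
    unfolding x using Sle[of "y n" q] Tle[of "y n" q] that \<delta>
    by (intro norm_convex_combination_sq_le) auto
  have x_le_w: "norm (x (Suc (Suc n)) - q) \<le> norm (w n - q)" if "S q = q" "T q = q" for n q
  proof (rule power2_le_imp_le)
    have "0 \<le> \<delta>\<^sup>2 * (norm (w n - S (w n)))\<^sup>2" "0 \<le> \<delta>\<^sup>2 * (norm (S (y n) - T (y n)))\<^sup>2" by auto
    then show "(norm (x (Suc (Suc n)) - q))\<^sup>2 \<le> (norm (w n - q))\<^sup>2"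
      using y_le[of q n] x_le[of q n] that by linarith
  qed simp
  obtain W where W: "\<And>n. norm (w n) \<le> W" using bdd by (auto simp: bounded_iff)
  \<comment> \<open>From index 2 on, \<open>norm (x n)\<close> is at most
    \<open>norm (w m - p) + norm p\<close>; the two starting points are arbitrary and enter
    separately.\<close>
  define K where "K = Max {norm (x 0), norm (x 1), W + 2 * norm p}"
  have K: "norm (x n) \<le> K" for n
  proof -
    consider "n = 0" | "n = 1" | m where "n = Suc (Suc m)" by (metis One_nat_def not0_implies_Suc)
    then show ?thesis
    proof cases
      case 3
      have "norm (x n) \<le> norm (x n - p) + norm p" using norm_triangle_ineq[of "x n - p" p] by simp
      also have "norm (x n - p) \<le> norm (w m - p)" using x_le_w p 3 by simp
      also have "norm (w m - p) \<le> W + norm p" using W[of m] norm_triangle_ineq4[of "w m" p] by simp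
      finally show ?thesis by (simp add: K_def)
    qed (auto simp: K_def)
  qed
  define \<epsilon> where "\<epsilon> n = \<theta> n * norm (x (Suc n) - x n)" for n
  have \<epsilon>0: "0 \<le> \<epsilon> n" for n using \<theta>(2) by (simp add: \<epsilon>_def)
  have \<epsilon>le: "\<epsilon> n \<le> \<theta> n * (2 * K)" for n
    unfolding \<epsilon>_def using K[of n] K[of "Suc n"] norm_triangle_ineq4[of "x (Suc n)" "x n"]
    by (intro mult_left_mono \<theta>(2)) linarith
  have \<epsilon>: "summable \<epsilon>"
    by (rule summable_comparison_test'[OF summable_mult2[OF \<theta>(1)], of 0]) (use \<epsilon>0 \<epsilon>le in auto)
  have wx: "norm (w n - x (Suc n)) = \<epsilon> n" for n
    using \<theta>(2) by (simp add: w \<epsilon>_def)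
  have conv: "convergent (\<lambda>n. norm (x n - q))" if q: "S q = q" "T q = q" for q
  proof -
    have "norm (x (Suc (Suc n)) - q) \<le> norm (x (Suc n) - q) + \<epsilon> n" for n
      using x_le_w[OF q, of n] norm_triangle_ineq[of "x (Suc n) - q" "w n - x (Suc n)"] wx[of n]
      by (simp add: algebra_simps)
    then have "convergent (\<lambda>n. norm (x (Suc n) - q))"
      using \<epsilon> \<epsilon>0 by (intro quasi_Fejer_convergent) auto
    then show ?thesis by (subst (asm) convergent_Suc_iff)
  qed
  have wx_lim: "(\<lambda>n. w n - x (Suc n)) \<longlonglongrightarrow> 0"
    using summable_LIMSEQ_zero[OF \<epsilon>] by (subst tendsto_norm_zero_iff[symmetric]) (simp add: wx)
  obtain l where l: "(\<lambda>n. norm (x n - p)) \<longlonglongrightarrow> l" using conv p convergent_def by blast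
  have wl: "(\<lambda>n. norm (w n - p)) \<longlonglongrightarrow> l"
  proof (rule Lim_transform)
    show "(\<lambda>n. norm (x (Suc n) - p)) \<longlonglongrightarrow> l" using l by (rule LIMSEQ_Suc)
    show "(\<lambda>n. norm (w n - p) - norm (x (Suc n) - p)) \<longlonglongrightarrow> 0"
    proof (rule Lim_null_comparison[OF _ tendsto_norm_zero[OF wx_lim]])
      show "\<forall>\<^sub>F n in sequentially. norm (norm (w n - p) - norm (x (Suc n) - p)) \<le> norm (w n - x (Suc n))"
      proof (intro always_eventually allI)
        show "norm (norm (w n - p) - norm (x (Suc n) - p)) \<le> norm (w n - x (Suc n))" for n
          using norm_triangle_ineq3[of "w n - p" "x (Suc n) - p"] by simp
      qed
    qed
  qed
  \<comment> \<open>The distances of \<open>w n\<close> and of \<open>x (Suc (Suc n))\<close> to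
    \<open>p\<close> share the limit \<open>l\<close>, and both deficits in \<open>y_le\<close> and
    \<open>x_le\<close> fit between their squares.\<close>
  have gap: "(\<lambda>n. ((norm (w n - p))\<^sup>2 - (norm (x (Suc (Suc n)) - p))\<^sup>2) / \<delta>\<^sup>2) \<longlonglongrightarrow> (l\<^sup>2 - l\<^sup>2) / \<delta>\<^sup>2"
    using \<delta>(1) by (intro tendsto_intros wl LIMSEQ_Suc l) auto
  have zero: "u \<longlonglongrightarrow> 0"
    if "\<And>n. \<delta>\<^sup>2 * (norm (u n))\<^sup>2 \<le> (norm (w n - p))\<^sup>2 - (norm (x (Suc (Suc n)) - p))\<^sup>2" for u :: "nat \<Rightarrow> 'a"
  proof -
    have "(\<lambda>n. (norm (u n))\<^sup>2) \<longlonglongrightarrow> 0"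
    proof (rule Lim_null_comparison)
      show "\<forall>\<^sub>F n in sequentially. norm ((norm (u n))\<^sup>2)
          \<le> ((norm (w n - p))\<^sup>2 - (norm (x (Suc (Suc n)) - p))\<^sup>2) / \<delta>\<^sup>2"
        using that \<delta>(1) by (intro always_eventually) (simp add: pos_le_divide_eq mult.commute)
      show "(\<lambda>n. ((norm (w n - p))\<^sup>2 - (norm (x (Suc (Suc n)) - p))\<^sup>2) / \<delta>\<^sup>2) \<longlonglongrightarrow> 0"
        using gap by simp
    qed
    then show ?thesis by (simp add: tendsto_norm_zero_iff)
  qed
  have nonneg: "0 \<le> \<delta>\<^sup>2 * (norm u)\<^sup>2" for u :: 'a by simp
  have Sw: "(\<lambda>n. w n - S (w n)) \<longlonglongrightarrow> 0"
  proof (rule zero)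
    show "\<delta>\<^sup>2 * (norm (w n - S (w n)))\<^sup>2
        \<le> (norm (w n - p))\<^sup>2 - (norm (x (Suc (Suc n)) - p))\<^sup>2" for n
      using y_le[OF p(1), of n] x_le[OF p, of n] nonneg[of "S (y n) - T (y n)"] by linarith
  qed
  have STy: "(\<lambda>n. S (y n) - T (y n)) \<longlonglongrightarrow> 0"
  proof (rule zero)
    show "\<delta>\<^sup>2 * (norm (S (y n) - T (y n)))\<^sup>2
        \<le> (norm (w n - p))\<^sup>2 - (norm (x (Suc (Suc n)) - p))\<^sup>2" for n
      using y_le[OF p(1), of n] x_le[OF p, of n] nonneg[of "w n - S (w n)"] by linarith
  qed
  have yw: "(\<lambda>n. y n - w n) \<longlonglongrightarrow> 0"
  proof (rule Lim_null_comparison[OF _ tendsto_norm_zero[OF Sw]])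
    have "norm (y n - w n) \<le> norm (w n - S (w n))" for n
    proof -
      have "y n - w n = - (\<beta> n *\<^sub>R (w n - S (w n)))" by (simp add: y algebra_simps)
      then have "norm (y n - w n) = \<bar>\<beta> n\<bar> * norm (w n - S (w n))" by simp
      also have "\<dots> \<le> 1 * norm (w n - S (w n))" using \<delta>(1) \<delta>(3)[of n] by (intro mult_right_mono) auto
      finally show ?thesis by simp
    qed
    then show "\<forall>\<^sub>F n in sequentially. norm (y n - w n) \<le> norm (w n - S (w n))" by simp
  qed
  \<comment> \<open>Being asymptotically fixed passes between sequences with vanishing difference;
    it is used to go from \<open>w\<close> to \<open>y\<close> and on to \<open>x\<close>.\<close>
  have transfer: "(\<lambda>n. v n - R (v n)) \<longlonglongrightarrow> 0"
    if R: "nonexpansive R" and u: "(\<lambda>n. u n - R (u n)) \<longlonglongrightarrow> 0" and uv: "(\<lambda>n. u n - v n) \<longlonglongrightarrow> 0"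
    for R :: "'a \<Rightarrow> 'a" and u v
  proof (rule Lim_null_comparison)
    show "(\<lambda>n. 2 * norm (u n - v n) + norm (u n - R (u n))) \<longlonglongrightarrow> 0"
      using tendsto_add[OF tendsto_mult[OF tendsto_const tendsto_norm_zero[OF uv]] tendsto_norm_zero[OF u]]
      by simp
    have "norm (v n - R (v n)) \<le> 2 * norm (u n - v n) + norm (u n - R (u n))" for n
    proof -
      have "v n - R (v n) = (u n - R (u n)) - (u n - v n) + (R (u n) - R (v n))" by simp
      moreover have "norm (R (u n) - R (v n)) \<le> norm (u n - v n)" using R by (simp add: nonexpansive_def)
      ultimately show ?thesis
        using norm_triangle_ineq[of "(u n - R (u n)) - (u n - v n)" "R (u n) - R (v n)"]
          norm_triangle_ineq4[of "u n - R (u n)" "u n - v n"] by simp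
    qed
    then show "\<forall>\<^sub>F n in sequentially. norm (v n - R (v n)) \<le> 2 * norm (u n - v n) + norm (u n - R (u n))"
      by simp
  qed
  have wy: "(\<lambda>n. w n - y n) \<longlonglongrightarrow> 0" using tendsto_minus[OF yw] by simp
  have yx: "(\<lambda>n. y n - x (Suc n)) \<longlonglongrightarrow> 0" using tendsto_add[OF yw wx_lim] by simp
  have Sy: "(\<lambda>n. y n - S (y n)) \<longlonglongrightarrow> 0" by (rule transfer[OF S Sw wy])
  have Ty: "(\<lambda>n. y n - T (y n)) \<longlonglongrightarrow> 0" using tendsto_add[OF Sy STy] by simp
  have "(\<lambda>n. x n - S (x n)) \<longlonglongrightarrow> 0" "(\<lambda>n. x n - T (x n)) \<longlonglongrightarrow> 0"
    using transfer[OF S Sy yx] transfer[OF T Ty yx] by (auto intro: LIMSEQ_imp_Suc)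
  then have "\<exists>q. (\<forall>R\<in>{S, T}. R q = q) \<and> weakly_converges x q"
    using S T K conv by (intro weak_convergence_to_common_fixed_point) (auto simp: bounded_iff)
  then show ?thesis by auto
qed

section \<open>Application to the split monotone inclusion problem\<close>

theorem theorem3p2:
  fixes g1 :: "'a::{real_inner, complete_space} \<Rightarrow> 'a"
    and g2 :: "'b::{real_inner, complete_space} \<Rightarrow> 'b"
    and B1 :: "'a \<Rightarrow> 'a set" and B2 :: "'b \<Rightarrow> 'b set"
    and A :: "'a \<Rightarrow> 'b"
    and S U J' :: "'a \<Rightarrow> 'a" and V :: "'b \<Rightarrow> 'b"
    and \<mu> \<nu> r \<gamma> :: real
    and \<Omega> \<Sigma> :: "'a set"
    and x w y :: "nat \<Rightarrow> 'a"
    and \<theta> \<alpha> \<beta> :: "nat \<Rightarrow> real"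
  assumes opial: "opial_property TYPE('a)"
    and g1: "inverse_strongly_monotone \<mu> g1"
    and g2: "inverse_strongly_monotone \<nu> g2"
    and B1: "maximal_monotone B1"
    and B2: "maximal_monotone B2"
    and A: "bounded_linear A"
    and r: "r > 0"
    and gamma: "\<gamma> > 0" "ereal \<gamma> < 2 / ereal (onorm (adjoint A \<circ> A))"
    and U: "U = (\<lambda>z. resolvent B1 r (z - r *\<^sub>R g1 z))"
    and V: "V = (\<lambda>z. resolvent B2 r (z - r *\<^sub>R g2 z))"
    and J': "J' = (\<lambda>z. U (z + \<gamma> *\<^sub>R adjoint A (V (A z) - A z)))"
    and S_nonexp: "nonexpansive S"
    and J'_nonexp: "nonexpansive J'"
    and Omega: "\<Omega> = split_inclusion_solutions g1 B1 g2 B2 A"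
    and Sigma: "\<Sigma> = fixed_points S \<inter> \<Omega>"
    and Sigma_ne: "\<Sigma> \<noteq> {}"
    and w: "\<And>n. n \<ge> 1 \<Longrightarrow> w n = x n + \<theta> n *\<^sub>R (x n - x (n - 1))"
    and y: "\<And>n. n \<ge> 1 \<Longrightarrow> y n = (1 - \<beta> n) *\<^sub>R w n + \<beta> n *\<^sub>R S (w n)"
    and x: "\<And>n. n \<ge> 1 \<Longrightarrow> x (n + 1) = (1 - \<alpha> n) *\<^sub>R S (y n) + \<alpha> n *\<^sub>R J' (y n)"
    and D1: "summable (\<lambda>n. \<theta> (Suc n))"
            "\<exists>t. 0 \<le> t \<and> t < 1 \<and> (\<forall>n\<ge>1. \<theta> n \<in> {0..t})"
    and D2: "\<exists>\<delta>. 0 < \<delta> \<and> \<delta> < 1/2 \<and>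
               (\<forall>n\<ge>1. \<alpha> n \<in> {\<delta>..1 - \<delta>} \<and> \<beta> n \<in> {\<delta>..1 - \<delta>})"
    and D3: "bounded {S (w n) - w n | n. n \<ge> 1}"
            "\<And>p. p \<in> \<Sigma> \<Longrightarrow> bounded {S (w n) - p | n. n \<ge> 1}"
    and D4: "bounded {J' (w n) - w n | n. n \<ge> 1}"
            "\<And>p. p \<in> \<Sigma> \<Longrightarrow> bounded {J' (w n) - p | n. n \<ge> 1}"
  shows "\<exists>q \<in> fixed_points S \<inter> fixed_points J'. weakly_converges x q"
proof -
  obtain p where p: "p \<in> \<Sigma>" using Sigma_ne by blast
  then have Sp: "S p = p" and p1: "0 \<in> (\<lambda>u. g1 p + u) ` B1 p"
    and p2: "0 \<in> (\<lambda>v. g2 (A p) + v) ` B2 (A p)"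
    by (auto simp: Sigma Omega fixed_points_def split_inclusion_solutions_def)
  have "U p = p"
    unfolding U using B1 r p1 by (intro forward_backward_fixed_point) (auto simp: maximal_monotone_def)
  moreover have "V (A p) = A p"
    unfolding V using B2 r p2 by (intro forward_backward_fixed_point) (auto simp: maximal_monotone_def)
  \<comment> \<open>As \<open>V\<close> fixes \<open>A p\<close>, the correction term at
    \<open>p\<close> is a multiple of \<open>adjoint A 0\<close>, so \<open>J' p\<close> reduces to
    \<open>U p\<close>.\<close>
  ultimately have Jp: "J' p = p" by (simp add: J' adjoint_zero[OF A])
  obtain \<delta> where \<delta>: "0 < \<delta>" "\<And>n. n \<ge> 1 \<Longrightarrow> \<alpha> n \<in> {\<delta>..1 - \<delta>}" "\<And>n. n \<ge> 1 \<Longrightarrow> \<beta> n \<in> {\<delta>..1 - \<delta>}"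
    using D2 by blast
  have bdd: "bounded (range (\<lambda>n. w (Suc n)))"
  proof -
    obtain a where a: "\<And>n. n \<ge> 1 \<Longrightarrow> norm (S (w n) - w n) \<le> a"
      using D3(1) unfolding bounded_iff by blast
    obtain b where b: "\<And>n. n \<ge> 1 \<Longrightarrow> norm (S (w n) - p) \<le> b"
      using D3(2)[OF p] unfolding bounded_iff by blast
    have "norm (w (Suc n)) \<le> a + b + norm p" for n
    proof -
      have "w (Suc n) = (S (w (Suc n)) - p) - (S (w (Suc n)) - w (Suc n)) + p" by simp
      then have "norm (w (Suc n)) \<le> norm (S (w (Suc n)) - p) + norm (S (w (Suc n)) - w (Suc n)) + norm p"
        by (metis norm_triangle_ineq norm_triangle_ineq4 add_right_mono order_trans)
      then show ?thesis using a[of "Suc n"] b[of "Suc n"] by simp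
    qed
    then show ?thesis by (auto simp: bounded_iff)
  qed
  have "\<exists>q. S q = q \<and> J' q = q \<and> weakly_converges x q"
  \<comment> \<open>The scheme starts at index 1: every sequence but \<open>x\<close> is
    instantiated at \<open>Suc n\<close>.\<close>
  proof (rule inertial_iteration_weak_convergence[OF S_nonexp J'_nonexp Sp Jp _ _ _ D1(1) _ \<delta>(1) _ _ bdd])
    fix n
    show "w (Suc n) = x (Suc n) + \<theta> (Suc n) *\<^sub>R (x (Suc n) - x n)" using w[of "Suc n"] by simp
    show "y (Suc n) = (1 - \<beta> (Suc n)) *\<^sub>R w (Suc n) + \<beta> (Suc n) *\<^sub>R S (w (Suc n))"
      using y[of "Suc n"] by simp
    show "x (Suc (Suc n)) = (1 - \<alpha> (Suc n)) *\<^sub>R S (y (Suc n)) + \<alpha> (Suc n) *\<^sub>R J' (y (Suc n))"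
      using x[of "Suc n"] by simp
    show "0 \<le> \<theta> (Suc n)" using D1(2) by force
    show "\<alpha> (Suc n) \<in> {\<delta>..1 - \<delta>}" "\<beta> (Suc n) \<in> {\<delta>..1 - \<delta>}" using \<delta>(2,3)[of "Suc n"] by simp_all
  qed
  then show ?thesis by (auto simp: fixed_points_def)
qed

end
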